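(* Let $\rho$ be a positive periodic function satisfying $$V,\rho\in C^2_{\rm per}([0,1]),\qquad \mu=\ln\rho+V\in C^3_{\rm per}([0,1]),\qquad \rho\ge\rho_*>0,$$ let $h=1/N$, $x_i=ih$, $x_{i+\frac12}=(i+\frac12)h$, and $P_h\rho:=(\rho(x_i))_{i=0}^{N-1}$. Assume also that $\widehat\rho_{i+\frac12}=\rho(x_{i+\frac12})+O(h^2)$ uniformly in $i$. Then $$\mathcal{F}_h[P_h\rho]=\mathcal{F}[\rho]+O(h^2),\qquad \triangle_h[P_h\rho]=\triangle[\rho]+O(h^2).$$ Moreover, for any of the five reconstructed coefficients $\gamma^{\rm rec}_{i+\frac12}$, ${\rm rec}\in\{\mathrm{ED},\mathrm{SG/WPE},\mathrm{IWPE},\mathrm{AM},\mathrm{LM}\}$, $$\triangle_h^{\rm ME}[P_h\rho]=\triangle_h[P_h\rho]+O(h^2)=\triangle[\rho]+O(h^2),$$ where $\triangle_h^{\rm ME}$ is the dissipation induced by $\gamma_{i+\frac12}=\gamma^{\rm rec}_{i+\frac12}$.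
   Context: Indices are periodic modulo $N$; $V_i=V(x_i)$; for a positive grid function $\bm\rho=(\rho_i)$, $\mu_i=\ln\rho_i+V_i$; $O(h^2)$ is as $h=1/N\to0$. $C^k_{\rm per}([0,1])$ denotes functions with $1$-periodic $C^k$ extension. Continuous functionals: $\mathcal{F}[\rho]=\int_0^1(\rho\ln\rho-\rho+\rho V)\,\mathrm{d}x$, $\triangle[\rho]=\int_0^1\rho\,|\partial_x\mu|^2\,\mathrm{d}x$. Discrete functionals: $\mathcal{F}_h[\bm\rho]=h\sum_{i=0}^{N-1}(\rho_i\ln\rho_i-\rho_i+\rho_iV_i)$; $\triangle_h[\bm\rho]=h\sum_{i=0}^{N-1}\widehat\rho_{i+\frac12}\left|\frac{\mu_{i+1}-\mu_i}{h}\right|^2$, where $\widehat\rho_{i+\frac12}$ is an interface density reconstructed from $\bm\rho$; and, for edge coefficients $\gamma_{i+\frac12}$, $\triangle_h^{\rm ME}[\bm\rho]=h\sum_{i=0}^{N-1}\gamma_{i+\frac12}\frac{e^{\mu_{i+1}}-e^{\mu_i}}{h}\frac{\mu_{i+1}-\mu_i}{h}$. Reconstructed coefficients, with logarithmic mean $L(a,b)=\frac{b-a}{\ln b-\ln a}$ for $a\ne b$, $L(a,a)=a$: $\gamma^{\rm ED}_{i+\frac12}=\sqrt{e^{-V_i}e^{-V_{i+1}}}$; $\gamma^{\rm SG/WPE}_{i+\frac12}=1/L(e^{V_i},e^{V_{i+1}})$; $\gamma^{\rm IWPE}_{i+\frac12}=\frac{2}{e^{V_i}+e^{V_{i+1}}}$;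 $\gamma^{\rm AM}_{i+\frac12}=\frac{e^{-V_i}+e^{-V_{i+1}}}{2}$; $\gamma^{\rm LM}_{i+\frac12}=L(e^{-V_i},e^{-V_{i+1}})$. *)

theory Defs
  imports "HOL-Analysis.Analysis" "HOL-Library.Landau_Symbols"
begin

definition C_k :: "nat \<Rightarrow> (real \<Rightarrow> real) \<Rightarrow> bool" where
  "C_k k f \<longleftrightarrow>
     (\<forall>j<k. \<forall>x. (deriv ^^ j) f field_differentiable (at x)) \<and>
     continuous_on UNIV ((deriv ^^ k) f)"

text \<open>A function on the unit interval with a 1-periodic \<open>C\<^sup>k\<close> extension is identified with that
  (unique) extension to the real line.\<close>

definition C_per :: "nat \<Rightarrow> (real \<Rightarrow> real) \<Rightarrow> bool" where
  "C_per k f \<longleftrightarrow> (\<forall>x. f (x + 1) = f x) \<and> C_k k f"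

definition chem_pot :: "(real \<Rightarrow> real) \<Rightarrow> (real \<Rightarrow> real) \<Rightarrow> real \<Rightarrow> real" where
  "chem_pot V \<rho> x = ln (\<rho> x) + V x"

definition free_energy :: "(real \<Rightarrow> real) \<Rightarrow> (real \<Rightarrow> real) \<Rightarrow> real" where
  "free_energy V \<rho> = integral {0..1} (\<lambda>x. \<rho> x * ln (\<rho> x) - \<rho> x + \<rho> x * V x)"

definition dissipation :: "(real \<Rightarrow> real) \<Rightarrow> (real \<Rightarrow> real) \<Rightarrow> real" where
  "dissipation V \<rho> = integral {0..1} (\<lambda>x. \<rho> x * \<bar>deriv (chem_pot V \<rho>) x\<bar>\<^sup>2)"

text \<open>A grid function is a map \<open>nat \<Rightarrow> real\<close>; the functionals evaluate it only at the indices
  \<open>0, \<dots>, N - 1\<close> are used; the successor of an index is taken modulo \<open>N\<close>. The interface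
  \<open>i + 1/2\<close> between the nodes \<open>i\<close> and \<open>i + 1\<close> is indexed by \<open>i\<close>.\<close>

definition mesh :: "nat \<Rightarrow> real" where
  "mesh N = 1 / real N"

definition grid_point :: "nat \<Rightarrow> nat \<Rightarrow> real" where
  "grid_point N i = real i * mesh N"

definition mid_point :: "nat \<Rightarrow> nat \<Rightarrow> real" where
  "mid_point N i = (real i + 1/2) * mesh N"

definition next_idx :: "nat \<Rightarrow> nat \<Rightarrow> nat" where
  "next_idx N i = Suc i mod N"

definition grid_proj :: "nat \<Rightarrow> (real \<Rightarrow> real) \<Rightarrow> nat \<Rightarrow> real" where
  "grid_proj N f i = f (grid_point N i)"

definition chem_pot_h :: "nat \<Rightarrow> (real \<Rightarrow> real) \<Rightarrow> (nat \<Rightarrow> real) \<Rightarrow> nat \<Rightarrow> real" where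
  "chem_pot_h N V r i = ln (r i) + V (grid_point N i)"

definition free_energy_h :: "nat \<Rightarrow> (real \<Rightarrow> real) \<Rightarrow> (nat \<Rightarrow> real) \<Rightarrow> real" where
  "free_energy_h N V r =
     mesh N * (\<Sum>i<N. r i * ln (r i) - r i + r i * V (grid_point N i))"

text \<open>\<open>R N r i\<close> is the interface density at \<open>i + 1/2\<close> reconstructed from the grid function
  \<open>r\<close>.\<close>

definition dissipation_h ::
  "nat \<Rightarrow> (real \<Rightarrow> real) \<Rightarrow> (nat \<Rightarrow> (nat \<Rightarrow> real) \<Rightarrow> nat \<Rightarrow> real) \<Rightarrow> (nat \<Rightarrow> real) \<Rightarrow> real" where
  "dissipation_h N V R r =
     mesh N * (\<Sum>i<N. R N r i *
       \<bar>(chem_pot_h N V r (next_idx N i) - chem_pot_h N V r i) / mesh N\<bar>\<^sup>2)"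

definition dissipation_ME ::
  "nat \<Rightarrow> (real \<Rightarrow> real) \<Rightarrow> (nat \<Rightarrow> real) \<Rightarrow> (nat \<Rightarrow> real) \<Rightarrow> real" where
  "dissipation_ME N V \<gamma> r =
     mesh N * (\<Sum>i<N. \<gamma> i *
       ((exp (chem_pot_h N V r (next_idx N i)) - exp (chem_pot_h N V r i)) / mesh N) *
       ((chem_pot_h N V r (next_idx N i) - chem_pot_h N V r i) / mesh N))"

definition log_mean :: "real \<Rightarrow> real \<Rightarrow> real" where
  "log_mean a b = (if a = b then a else (b - a) / (ln b - ln a))"

datatype recon = ED | SG_WPE | IWPE | AM | LM

fun edge_coeff :: "recon \<Rightarrow> real \<Rightarrow> real \<Rightarrow> real" where
  "edge_coeff ED v w = sqrt (exp (- v) * exp (- w))"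
| "edge_coeff SG_WPE v w = 1 / log_mean (exp v) (exp w)"
| "edge_coeff IWPE v w = 2 / (exp v + exp w)"
| "edge_coeff AM v w = (exp (- v) + exp (- w)) / 2"
| "edge_coeff LM v w = log_mean (exp (- v)) (exp (- w))"

definition gamma_rec :: "recon \<Rightarrow> nat \<Rightarrow> (real \<Rightarrow> real) \<Rightarrow> nat \<Rightarrow> real" where
  "gamma_rec rec N V i =
     edge_coeff rec (V (grid_point N i)) (V (grid_point N (next_idx N i)))"

end

theory Submission
  imports Defs
begin

text \<open>
  Every discrete functional here is \<open>h\<close> times a sum over the interfaces \<open>i + 1/2\<close>, and in each
  case the summand equals the value at the midpoint \<open>x\<^bsub>i+1/2\<^esub>\<close> of the continuous integrand \<open>g\<close>,
  up to \<open>O(h\<^sup>2)\<close> uniformly in \<open>i\<close>. Since the midpoint rule for a function with bounded second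
  derivative is itself exact up to \<open>O(h\<^sup>2)\<close>, the functional is within \<open>O(h\<^sup>2)\<close> of the integral of
  \<open>g\<close> (\<open>midpoint_consistent_quadrature\<close>). It remains to see that the ingredients of the summands
  are consistent to second order at the midpoints, a property that products of bounded
  functions inherit.

  \<^item> The free energy sums a periodic function over the nodes. By periodicity the nodal values may
    be replaced by the averages of the two nodes of an interface, and such an average is
    second-order consistent because the linear Taylor terms cancel. With
    \<open>\<mu> = ln \<rho> + V\<close> the integrand is \<open>\<rho> (\<mu> - 1)\<close>, so its smoothness follows from that of
    \<open>\<rho>\<close> and \<open>\<mu>\<close>.

  \<^item> The difference quotients of \<open>\<mu>\<close> and of \<open>exp \<mu>\<close> are consistent with their derivatives: a
    centred difference of \<open>f\<close> is the integral of \<open>f'\<close> over a cell, so this is the midpoint rule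
    again, now for \<open>f'\<close>, and it draws on three derivatives of \<open>\<mu>\<close>.

  \<^item> All five edge coefficients lie between the harmonic and the arithmetic mean of the nodal
    values of \<open>exp (- V)\<close> (\<open>edge_coeff_bounds\<close>). The arithmetic mean is a nodal average as
    above, the harmonic mean is the reciprocal of such an average for \<open>exp V\<close>, and so both bounds,
    and everything between them, are consistent with \<open>exp (- V)\<close>.

  Both dissipations then have summands consistent with the same \<open>g = \<rho> \<mu>'\<^sup>2\<close>, because
  \<open>exp (- V) (exp \<mu>)' \<mu>' = exp (- V) exp \<mu> \<mu>'\<^sup>2 = \<rho> \<mu>'\<^sup>2\<close>.
\<close>

section \<open>Functions with two bounded derivatives\<close>

text \<open>Periodic \<open>C\<^sup>2\<close> functions have these global bounds, which make the error constants uniform in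
  the position and pass to sums, products and exponentials.\<close>
definition bounded_C2 :: "(real \<Rightarrow> real) \<Rightarrow> bool" where
  "bounded_C2 f \<longleftrightarrow> (\<exists>f' f''.
     (\<forall>x. (f has_real_derivative f' x) (at x)) \<and>
     (\<forall>x. (f' has_real_derivative f'' x) (at x)) \<and>
     bounded (range f) \<and> bounded (range f') \<and> bounded (range f''))"

lemma bounded_C2I:
  assumes "\<And>x. (f has_real_derivative f' x) (at x)"
    and "\<And>x. (f' has_real_derivative f'' x) (at x)"
    and "bounded (range f)" "bounded (range f')" "bounded (range f'')"
  shows "bounded_C2 f"
  using assms unfolding bounded_C2_def by blast

lemma bounded_range_real_iff:
  fixes f :: "'a \<Rightarrow> real"
  shows "bounded (range f) \<longleftrightarrow> (\<exists>B. \<forall>x. \<bar>f x\<bar> \<le> B)"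
  by (auto simp: bounded_iff)

lemma bounded_range_add:
  fixes f g :: "'a \<Rightarrow> real"
  assumes "bounded (range f)" "bounded (range g)"
  shows "bounded (range (\<lambda>x. f x + g x))"
  using assms bounded_plus_comp by blast

lemma bounded_range_mult:
  fixes f g :: "'a \<Rightarrow> real"
  assumes "bounded (range f)" "bounded (range g)"
  shows "bounded (range (\<lambda>x. f x * g x))"
proof -
  from assms obtain B C where "\<And>x. \<bar>f x\<bar> \<le> B" "\<And>x. \<bar>g x\<bar> \<le> C"
    by (auto simp: bounded_range_real_iff)
  hence "\<bar>f x * g x\<bar> \<le> B * C" for x
    unfolding abs_mult by (intro mult_mono order_trans[OF abs_ge_zero]) auto
  thus ?thesis
    unfolding bounded_range_real_iff by blast
qed

lemma bounded_range_exp: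
  fixes f :: "'a \<Rightarrow> real"
  assumes "bounded (range f)"
  shows "bounded (range (\<lambda>x. exp (f x)))"
proof -
  from assms obtain B where B: "\<And>x. \<bar>f x\<bar> \<le> B"
    by (auto simp: bounded_range_real_iff)
  have "\<bar>exp (f x)\<bar> \<le> exp B" for x
    using B[of x] by (simp add: abs_le_iff)
  thus ?thesis
    unfolding bounded_range_real_iff by blast
qed

lemma bounded_C2_const: "bounded_C2 (\<lambda>_. c)"
  by (rule bounded_C2I[where f' = "\<lambda>_. 0" and f'' = "\<lambda>_. 0"]) simp_all

lemma bounded_C2_add:
  assumes "bounded_C2 f" "bounded_C2 g"
  shows "bounded_C2 (\<lambda>x. f x + g x)"
proof -
  obtain f' f'' where f: "\<And>x. (f has_real_derivative f' x) (at x)"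
    "\<And>x. (f' has_real_derivative f'' x) (at x)"
    "bounded (range f)" "bounded (range f')" "bounded (range f'')"
    using assms(1) unfolding bounded_C2_def by blast
  obtain g' g'' where g: "\<And>x. (g has_real_derivative g' x) (at x)"
    "\<And>x. (g' has_real_derivative g'' x) (at x)"
    "bounded (range g)" "bounded (range g')" "bounded (range g'')"
    using assms(2) unfolding bounded_C2_def by blast
  show ?thesis
    by (rule bounded_C2I[where f' = "\<lambda>x. f' x + g' x" and f'' = "\<lambda>x. f'' x + g'' x"])
      (intro bounded_range_add f g DERIV_add)+
qed

lemma bounded_C2_mult:
  assumes "bounded_C2 f" "bounded_C2 g"
  shows "bounded_C2 (\<lambda>x. f x * g x)"
proof -
  obtain f' f'' where f: "\<And>x. (f has_real_derivative f' x) (at x)"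
    "\<And>x. (f' has_real_derivative f'' x) (at x)"
    "bounded (range f)" "bounded (range f')" "bounded (range f'')"
    using assms(1) unfolding bounded_C2_def by blast
  obtain g' g'' where g: "\<And>x. (g has_real_derivative g' x) (at x)"
    "\<And>x. (g' has_real_derivative g'' x) (at x)"
    "bounded (range g)" "bounded (range g')" "bounded (range g'')"
    using assms(2) unfolding bounded_C2_def by blast
  show ?thesis
    by (rule bounded_C2I[where f' = "\<lambda>x. f' x * g x + g' x * f x"
          and f'' = "\<lambda>x. (f'' x * g x + g' x * f' x) + (g'' x * f x + f' x * g' x)"])
      (intro bounded_range_add bounded_range_mult f g DERIV_add DERIV_mult)+
qed

lemma bounded_C2_diff:
  assumes "bounded_C2 f" "bounded_C2 g"
  shows "bounded_C2 (\<lambda>x. f x - g x)"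
  using bounded_C2_add[OF assms(1) bounded_C2_mult[OF bounded_C2_const[of "-1"] assms(2)]]
  by simp

lemma bounded_C2_minus: "bounded_C2 f \<Longrightarrow> bounded_C2 (\<lambda>x. - f x)"
  using bounded_C2_diff[OF bounded_C2_const[of 0]] by simp

lemma bounded_C2_exp:
  assumes "bounded_C2 f"
  shows "bounded_C2 (\<lambda>x. exp (f x))"
proof -
  obtain f' f'' where f: "\<And>x. (f has_real_derivative f' x) (at x)"
    "\<And>x. (f' has_real_derivative f'' x) (at x)"
    "bounded (range f)" "bounded (range f')" "bounded (range f'')"
    using assms unfolding bounded_C2_def by blast
  have exp: "((\<lambda>x. exp (f x)) has_real_derivative exp (f x) * f' x) (at x)" for x
    using f(1) by (auto intro!: derivative_eq_intros)
  show ?thesis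
    by (rule bounded_C2I[where f' = "\<lambda>x. exp (f x) * f' x"
          and f'' = "\<lambda>x. (exp (f x) * f' x) * f' x + f'' x * exp (f x)"])
      (intro bounded_range_add bounded_range_mult bounded_range_exp f exp DERIV_mult)+
qed

lemma bounded_C2_imp_bounded: "bounded_C2 f \<Longrightarrow> bounded (range f)"
  unfolding bounded_C2_def by blast

lemma bounded_C2_imp_continuous_on: "bounded_C2 f \<Longrightarrow> continuous_on A f"
  unfolding bounded_C2_def by (meson DERIV_isCont continuous_at_imp_continuous_on)

text \<open>The constant is a bound for \<open>f''\<close>, hence uniform in the base point; the same \<open>f'\<close> serves for
  increments of either sign, which lets symmetric combinations cancel the linear term.\<close>
lemma bounded_C2_taylor:
  assumes "bounded_C2 f"
  obtains f' K where "K \<ge> 0" "\<And>x t. \<bar>f (x + t) - f x - f' x * t\<bar> \<le> K * t\<^sup>2"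
proof -
  obtain f' f'' where f: "\<And>x. (f has_real_derivative f' x) (at x)"
    "\<And>x. (f' has_real_derivative f'' x) (at x)" "bounded (range f'')"
    using assms unfolding bounded_C2_def by blast
  obtain B where B: "\<And>x. \<bar>f'' x\<bar> \<le> B"
    using f(3) by (auto simp: bounded_range_real_iff)
  show thesis
  proof
    show "B \<ge> 0"
      using B[of 0] by simp
    fix x t
    \<comment> \<open>The derivatives at the shifted base point, since the remainder formula expands at \<open>0\<close>.\<close>
    define D where
      "D = (\<lambda>k::nat. if k = 0 then (\<lambda>s. f (x + s)) else if k = 1 then (\<lambda>s. f' (x + s))
         else (\<lambda>s::real. f'' (x + s)))"
    have "(D m has_real_derivative D (Suc m) s) (at s)" if "m < 2" for m :: nat and s
    proof -
      have "m = 0 \<or> m = 1" using that by auto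
      thus ?thesis
        using f(1,2)[of "x + s"] by (auto simp: D_def DERIV_shift add.commute)
    qed
    moreover have "D 0 = (\<lambda>s. f (x + s))"
      by (simp add: D_def)
    ultimately obtain s where
      "f (x + t) = (\<Sum>m<2. D m 0 / fact m * t ^ m) + D 2 s / fact 2 * t ^ 2"
      using Maclaurin_bi_le[of D "\<lambda>s. f (x + s)" 2 t] by auto
    hence eq: "f (x + t) - f x - f' x * t = f'' (x + s) / 2 * t\<^sup>2"
      by (simp add: D_def numeral_2_eq_2)
    have "\<bar>f'' (x + s) / 2\<bar> \<le> B"
      using B[of "x + s"] by auto
    thus "\<bar>f (x + t) - f x - f' x * t\<bar> \<le> B * t\<^sup>2"
      unfolding eq by (simp only: abs_mult abs_power2 mult_right_mono zero_le_power2)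
  qed
qed

section \<open>Periodic functions\<close>

lemma periodic_add_of_nat:
  fixes f :: "real \<Rightarrow> 'a"
  assumes "\<And>x. f (x + 1) = f x"
  shows "f (x + of_nat n) = f x"
proof (induction n)
  case (Suc n)
  show ?case
    using assms[of "x + of_nat n"] Suc by (simp add: algebra_simps)
qed simp

lemma periodic_frac:
  fixes f :: "real \<Rightarrow> 'a"
  assumes "\<And>x. f (x + 1) = f x"
  shows "f (frac x) = f x"
proof (cases "x \<ge> 0")
  case True
  hence "x = frac x + of_nat (nat \<lfloor>x\<rfloor>)"
    by (simp add: frac_def)
  thus ?thesis
    using periodic_add_of_nat[of f, OF assms] by metis
next
  case False
  hence "frac x = x + of_nat (nat (- \<lfloor>x\<rfloor>))"
    by (simp add: frac_def)
  thus ?thesis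
    using periodic_add_of_nat[of f, OF assms] by metis
qed

lemma periodic_continuous_imp_bounded:
  fixes f :: "real \<Rightarrow> real"
  assumes "\<And>x. f (x + 1) = f x" "continuous_on UNIV f"
  shows "bounded (range f)"
proof -
  have "bounded (f ` {0..1})"
    using assms(2) by (intro compact_imp_bounded compact_continuous_image)
      (auto intro: continuous_on_subset)
  moreover have "f x \<in> f ` {0..1}" for x
    using periodic_frac[of f x, OF assms(1)] frac_lt_1[of x]
    by (metis atLeastAtMost_iff frac_ge_0 image_eqI less_eq_real_def)
  ultimately show ?thesis
    by (metis bounded_subset image_subset_iff)
qed

text \<open>Having derivative \<open>D\<close> at \<open>x\<close> and at \<open>x + 1\<close> are equivalent for every \<open>D\<close>, so the choice made
  by \<^const>\<open>deriv\<close> agrees even where \<open>f\<close> is not differentiable.\<close>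
lemma periodic_deriv:
  fixes f :: "real \<Rightarrow> real"
  assumes "\<And>x. f (x + 1) = f x"
  shows "deriv f (x + 1) = deriv f x"
proof -
  have "(f has_field_derivative D) (at (x + 1)) \<longleftrightarrow> (f has_field_derivative D) (at x)" for D
    using DERIV_shift[of f D x 1] assms by simp
  thus ?thesis
    unfolding deriv_def by simp
qed

lemma C_per_periodic_funpow_deriv:
  assumes "C_per k f"
  shows "(deriv ^^ j) f (x + 1) = (deriv ^^ j) f x"
proof (induction j arbitrary: x)
  case 0
  show ?case
    using assms by (simp add: C_per_def)
next
  case (Suc j)
  show ?case
    using periodic_deriv[of "(deriv ^^ j) f"] Suc by simp
qed

lemma C_per_has_derivative:
  assumes "C_per k f" "j < k"
  shows "((deriv ^^ j) f has_real_derivative (deriv ^^ Suc j) f x) (at x)"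
  using assms by (auto simp: C_per_def C_k_def field_differentiable_derivI)

lemma C_per_bounded_funpow_deriv:
  assumes "C_per k f" "j \<le> k"
  shows "bounded (range ((deriv ^^ j) f))"
proof (rule periodic_continuous_imp_bounded)
  show "(deriv ^^ j) f (x + 1) = (deriv ^^ j) f x" for x
    by (rule C_per_periodic_funpow_deriv[OF assms(1)])
  show "continuous_on UNIV ((deriv ^^ j) f)"
  proof (cases "j = k")
    case True
    thus ?thesis
      using assms by (simp add: C_per_def C_k_def)
  next
    case False
    hence "j < k"
      using assms(2) by simp
    thus ?thesis
      using C_per_has_derivative[OF assms(1)]
      by (meson DERIV_isCont continuous_at_imp_continuous_on)
  qed
qed

lemma C_per_bounded_C2:
  assumes "C_per k f" "j + 2 \<le> k"
  shows "bounded_C2 ((deriv ^^ j) f)"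
  using assms(2)
  by (intro bounded_C2I[where f' = "(deriv ^^ Suc j) f" and f'' = "(deriv ^^ Suc (Suc j)) f"]
      C_per_has_derivative[OF assms(1)] C_per_bounded_funpow_deriv[OF assms(1)]) auto

section \<open>Midpoint rule\<close>

text \<open>On an interval centred at \<open>m\<close> the linear part of the Taylor expansion at \<open>m\<close> integrates to
  zero, which leaves an error of the size of the quadratic remainder times the length.\<close>
lemma midpoint_rule:
  assumes "bounded_C2 g"
  obtains K where
    "\<And>m s. s \<ge> 0 \<Longrightarrow> \<bar>integral {m - s..m + s} g - 2 * s * g m\<bar> \<le> K * s ^ 3"
proof -
  obtain g' K where K: "K \<ge> 0" "\<And>x t. \<bar>g (x + t) - g x - g' x * t\<bar> \<le> K * t\<^sup>2"
    using bounded_C2_taylor[OF assms] by metis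
  show thesis
  proof
    fix m s :: real
    assume s: "s \<ge> 0"
    let ?I = "{m - s..m + s}"
    have affine: "((\<lambda>x. g m + g' m * (x - m)) has_integral
        (g m * (m + s) + g' m * (m + s - m)\<^sup>2 / 2) - (g m * (m - s) + g' m * (m - s - m)\<^sup>2 / 2)) ?I"
      by (rule fundamental_theorem_of_calculus)
        (use s in \<open>auto intro!: derivative_eq_intros
           simp: has_real_derivative_iff_has_vector_derivative[symmetric]\<close>)
    have g: "(g has_integral integral ?I g) ?I"
      by (intro integrable_integral integrable_continuous_real bounded_C2_imp_continuous_on assms)
    have "((\<lambda>x. g x - (g m + g' m * (x - m))) has_integral integral ?I g - 2 * s * g m) ?I"
      using has_integral_diff[OF g affine] by (simp add: algebra_simps)
    moreover have "norm (g x - (g m + g' m * (x - m))) \<le> K * s\<^sup>2" if "x \<in> cbox (m - s) (m + s)" for x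
    proof -
      have "\<bar>x - m\<bar> \<le> \<bar>s\<bar>" using that s by auto
      hence "(x - m)\<^sup>2 \<le> s\<^sup>2" by (simp add: abs_le_square_iff)
      hence "K * (x - m)\<^sup>2 \<le> K * s\<^sup>2" using K(1) by (rule mult_left_mono)
      thus ?thesis using K(2)[of m "x - m"] by simp
    qed
    ultimately have "norm (integral ?I g - 2 * s * g m) \<le>
        K * s\<^sup>2 * measure lborel (cbox (m - s) (m + s))"
      using K(1) by (intro has_integral_bound) auto
    thus "\<bar>integral ?I g - 2 * s * g m\<bar> \<le> 2 * K * s ^ 3"
      using s by (simp add: algebra_simps power2_eq_square power3_eq_cube)
  qed
qed

text \<open>By the fundamental theorem of calculus the difference is the integral of \<open>f'\<close>, to which the
  midpoint rule applies.\<close>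
lemma central_difference:
  assumes "\<And>x. (f has_real_derivative f' x) (at x)" "bounded_C2 f'"
  obtains K where
    "\<And>m s. s \<ge> 0 \<Longrightarrow> \<bar>f (m + s) - f (m - s) - 2 * s * f' m\<bar> \<le> K * s ^ 3"
proof -
  obtain K where K:
    "\<And>m s. s \<ge> 0 \<Longrightarrow> \<bar>integral {m - s..m + s} f' - 2 * s * f' m\<bar> \<le> K * s ^ 3"
    using midpoint_rule[OF assms(2)] by blast
  have ftc: "integral {m - s..m + s} f' = f (m + s) - f (m - s)" if "s \<ge> 0" for m s
    using that assms(1)
    by (intro integral_unique fundamental_theorem_of_calculus)
      (auto simp: has_real_derivative_iff_has_vector_derivative[symmetric]
        intro: has_field_derivative_at_within)
  show thesis
    using that[of K] K ftc by metis
qed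

lemma integral_eq_sum_cells:
  fixes g :: "real \<Rightarrow> real"
  assumes "continuous_on UNIV g" "h \<ge> 0"
  shows "integral {0..real n * h} g = (\<Sum>i<n. integral {real i * h..(real i + 1) * h} g)"
proof (induction n)
  case (Suc n)
  have "integral {0..real n * h} g + integral {real n * h..(real n + 1) * h} g
      = integral {0..(real n + 1) * h} g"
    using assms
    by (intro Henstock_Kurzweil_Integration.integral_combine integrable_continuous_real)
      (auto intro: continuous_on_subset mult_right_mono)
  thus ?case
    using Suc by (simp add: add.commute)
qed simp

section \<open>Second-order consistent edge quantities\<close>

text \<open>Only large \<open>N\<close> are considered, which admits reconstructions of the interface density that are
  accurate only on sufficiently fine grids.\<close>
definition midpoint_consistent :: "(nat \<Rightarrow> nat \<Rightarrow> real) \<Rightarrow> (real \<Rightarrow> real) \<Rightarrow> bool" where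
  "midpoint_consistent q f \<longleftrightarrow>
     (\<exists>C. \<forall>\<^sub>F N in sequentially. \<forall>i<N. \<bar>q N i - f (mid_point N i)\<bar> \<le> C * (mesh N)\<^sup>2)"

lemma midpoint_consistentI:
  assumes "\<And>N i. i < N \<Longrightarrow> \<bar>q N i - f (mid_point N i)\<bar> \<le> C * (mesh N)\<^sup>2"
  shows "midpoint_consistent q f"
  unfolding midpoint_consistent_def using assms by (intro exI[of _ C] always_eventually) blast

lemma midpoint_consistentE:
  assumes "midpoint_consistent q f"
  obtains C where "C \<ge> 0"
    "\<forall>\<^sub>F N in sequentially. \<forall>i<N. \<bar>q N i - f (mid_point N i)\<bar> \<le> C * (mesh N)\<^sup>2"
proof -
  obtain C where "\<forall>\<^sub>F N in sequentially. \<forall>i<N. \<bar>q N i - f (mid_point N i)\<bar> \<le> C * (mesh N)\<^sup>2"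
    using assms unfolding midpoint_consistent_def by blast
  moreover have "C * (mesh N)\<^sup>2 \<le> \<bar>C\<bar> * (mesh N)\<^sup>2" for N
    by (intro mult_right_mono) auto
  ultimately have "\<forall>\<^sub>F N in sequentially. \<forall>i<N. \<bar>q N i - f (mid_point N i)\<bar> \<le> \<bar>C\<bar> * (mesh N)\<^sup>2"
    by (elim eventually_mono) (meson order_trans)
  thus thesis
    using that[of "\<bar>C\<bar>"] by simp
qed

lemma mesh_nonneg: "mesh N \<ge> 0"
  and mesh_le_1: "mesh N \<le> 1"
  by (cases N; simp add: mesh_def field_simps)+

text \<open>The usual splitting \<open>a b - u v = (a - u) b + u (b - v)\<close>, where \<open>b\<close> is bounded because it is
  close to \<open>v\<close> and \<open>h \<le> 1\<close>.\<close>
lemma midpoint_consistent_mult: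
  assumes q: "midpoint_consistent q f" and r: "midpoint_consistent r g"
    and f: "bounded (range f)" and g: "bounded (range g)"
  shows "midpoint_consistent (\<lambda>N i. q N i * r N i) (\<lambda>x. f x * g x)"
proof -
  obtain C where C: "C \<ge> 0"
    "\<forall>\<^sub>F N in sequentially. \<forall>i<N. \<bar>q N i - f (mid_point N i)\<bar> \<le> C * (mesh N)\<^sup>2"
    using midpoint_consistentE[OF q] .
  obtain D where D: "D \<ge> 0"
    "\<forall>\<^sub>F N in sequentially. \<forall>i<N. \<bar>r N i - g (mid_point N i)\<bar> \<le> D * (mesh N)\<^sup>2"
    using midpoint_consistentE[OF r] .
  obtain A B where A: "\<And>x. \<bar>f x\<bar> \<le> A" and B: "\<And>x. \<bar>g x\<bar> \<le> B"
    using f g by (auto simp: bounded_range_real_iff)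
  have *: "\<bar>a * b - u * v\<bar> \<le> (C * (D + B) + A * D) * (mesh N)\<^sup>2"
    if a: "\<bar>a - u\<bar> \<le> C * (mesh N)\<^sup>2" and b: "\<bar>b - v\<bar> \<le> D * (mesh N)\<^sup>2" 
      and u: "\<bar>u\<bar> \<le> A" and v: "\<bar>v\<bar> \<le> B" for N a b u v
  proof -
    have "(mesh N)\<^sup>2 \<le> 1"
      by (simp add: mesh_nonneg mesh_le_1 power_le_one)
    hence "D * (mesh N)\<^sup>2 \<le> D"
      using D(1) by (simp add: mult_left_le)
    hence "\<bar>b\<bar> \<le> D + B"
      using b v by linarith
    hence "\<bar>a - u\<bar> * \<bar>b\<bar> \<le> (C * (mesh N)\<^sup>2) * (D + B)"
      using a C(1) by (intro mult_mono) auto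
    moreover have "\<bar>u\<bar> * \<bar>b - v\<bar> \<le> A * (D * (mesh N)\<^sup>2)"
      using b u by (intro mult_mono) auto
    moreover have "a * b - u * v = (a - u) * b + u * (b - v)"
      by (simp add: algebra_simps)
    ultimately show ?thesis
      by (simp add: algebra_simps abs_mult[symmetric])
  qed
  show ?thesis
    unfolding midpoint_consistent_def
    by (intro exI[of _ "C * (D + B) + A * D"] eventually_mono[OF eventually_conj[OF C(2) D(2)]])
      (use * A B in auto)
qed

lemma midpoint_consistent_inverse:
  assumes q: "midpoint_consistent q f" 
    and c: "c > 0" "\<And>N i. q N i \<ge> c" "\<And>x. f x \<ge> c"
  shows "midpoint_consistent (\<lambda>N i. inverse (q N i)) (\<lambda>x. inverse (f x))"
proof -
  obtain C where C: "C \<ge> 0"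
    "\<forall>\<^sub>F N in sequentially. \<forall>i<N. \<bar>q N i - f (mid_point N i)\<bar> \<le> C * (mesh N)\<^sup>2"
    using midpoint_consistentE[OF q] .
  have *: "\<bar>inverse a - inverse u\<bar> \<le> (C / c\<^sup>2) * (mesh N)\<^sup>2"
    if a: "\<bar>a - u\<bar> \<le> C * (mesh N)\<^sup>2" "a \<ge> c" "u \<ge> c" for N a u
  proof -
    have "c * c \<le> a * u"
      using a c(1) by (intro mult_mono) auto
    hence "\<bar>a - u\<bar> / (a * u) \<le> (C * (mesh N)\<^sup>2) / c\<^sup>2"
      using a(1) c(1) by (intro frac_le) (auto simp: power2_eq_square)
    moreover have "\<bar>inverse a - inverse u\<bar> = \<bar>a - u\<bar> / (a * u)"
      using a c(1) by (simp add: inverse_eq_divide diff_frac_eq abs_mult)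
    ultimately show ?thesis
      by simp
  qed
  show ?thesis
    unfolding midpoint_consistent_def
    by (intro exI[of _ "C / c\<^sup>2"] eventually_mono[OF C(2)]) (use * c in auto)
qed

lemma midpoint_consistent_squeeze:
  assumes l: "midpoint_consistent l f" and u: "midpoint_consistent u f"
    and between: "\<And>N i. l N i \<le> q N i" "\<And>N i. q N i \<le> u N i"
  shows "midpoint_consistent q f"
proof -
  obtain C where C: "C \<ge> 0"
    "\<forall>\<^sub>F N in sequentially. \<forall>i<N. \<bar>l N i - f (mid_point N i)\<bar> \<le> C * (mesh N)\<^sup>2"
    using midpoint_consistentE[OF l] .
  obtain D where D: "D \<ge> 0"
    "\<forall>\<^sub>F N in sequentially. \<forall>i<N. \<bar>u N i - f (mid_point N i)\<bar> \<le> D * (mesh N)\<^sup>2"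
    using midpoint_consistentE[OF u] .
  have *: "\<bar>b - v\<bar> \<le> (C + D) * (mesh N)\<^sup>2"
    if "\<bar>a - v\<bar> \<le> C * (mesh N)\<^sup>2" "\<bar>d - v\<bar> \<le> D * (mesh N)\<^sup>2" "a \<le> b" "b \<le> d" for N a b d v
  proof -
    have "C * (mesh N)\<^sup>2 \<ge> 0" "D * (mesh N)\<^sup>2 \<ge> 0"
      using C(1) D(1) by simp_all
    thus ?thesis
      unfolding distrib_right using that by linarith
  qed
  show ?thesis
    unfolding midpoint_consistent_def
    by (intro exI[of _ "C + D"] eventually_mono[OF eventually_conj[OF C(2) D(2)]])
      (use * between in blast)
qed

lemma grid_point_mid: "grid_point N i = mid_point N i - mesh N / 2"
  by (simp add: grid_point_def mid_point_def algebra_simps)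

text \<open>For the last interface the next index is \<open>0\<close>, while the right end point of the cell is \<open>1\<close>;
  periodicity identifies the two values.\<close>
lemma periodic_at_next_idx:
  assumes "\<And>x. f (x + 1) = f x" "i < N"
  shows "f (grid_point N (next_idx N i)) = f (mid_point N i + mesh N / 2)"
proof -
  have mid: "mid_point N i + mesh N / 2 = real (Suc i) * mesh N"
    by (simp add: mid_point_def algebra_simps)
  show ?thesis
  proof (cases "Suc i = N")
    case True
    have "f 0 = f 1"
      using assms(1)[of 0] by simp
    thus ?thesis
      unfolding mid using True by (auto simp: next_idx_def grid_point_def mesh_def)
  next
    case False
    hence "next_idx N i = Suc i"
      using assms(2) by (simp add: next_idx_def)
    thus ?thesis
      unfolding mid by (simp add: grid_point_def)
  qed
qed

lemma midpoint_consistent_average: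
  assumes per: "\<And>x. f (x + 1) = f x" and "bounded_C2 f"
  shows "midpoint_consistent
    (\<lambda>N i. (f (grid_point N i) + f (grid_point N (next_idx N i))) / 2) f"
proof -
  obtain f' K where K: "K \<ge> 0" "\<And>x t. \<bar>f (x + t) - f x - f' x * t\<bar> \<le> K * t\<^sup>2"
    using bounded_C2_taylor[OF assms(2)] by metis
  show ?thesis
  proof (rule midpoint_consistentI)
    fix N i :: nat
    assume i: "i < N"
    define m s where "m = mid_point N i" and "s = mesh N / 2"
    have "\<bar>f (m + s) - f m - f' m * s\<bar> \<le> K * s\<^sup>2"
      and "\<bar>f (m - s) - f m + f' m * s\<bar> \<le> K * s\<^sup>2"
      using K(2)[of m s] K(2)[of m "- s"] by simp_all
    hence "\<bar>f (m - s) + f (m + s) - 2 * f m\<bar> \<le> 2 * (K * s\<^sup>2)"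
      by linarith
    hence "\<bar>(f (m - s) + f (m + s)) / 2 - f m\<bar> \<le> K * s\<^sup>2"
      by (simp add: abs_le_iff field_simps)
    moreover have "K * s\<^sup>2 = K / 4 * (mesh N)\<^sup>2"
      by (simp add: s_def power2_eq_square)
    ultimately have "\<bar>(f (m - s) + f (m + s)) / 2 - f m\<bar> \<le> K / 4 * (mesh N)\<^sup>2"
      by (simp only:)
    thus "\<bar>(f (grid_point N i) + f (grid_point N (next_idx N i))) / 2
        - f (mid_point N i)\<bar> \<le> K / 4 * (mesh N)\<^sup>2"
      using periodic_at_next_idx[of f, OF per i]
      by (simp only: grid_point_mid[of N i] m_def s_def)
  qed
qed

lemma midpoint_consistent_difference_quotient:
  assumes per: "\<And>x. f (x + 1) = f x"
    and "\<And>x. (f has_real_derivative f' x) (at x)" "bounded_C2 f'"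
  shows "midpoint_consistent
    (\<lambda>N i. (f (grid_point N (next_idx N i)) - f (grid_point N i)) / mesh N) f'"
proof -
  obtain K where K:
    "\<And>m s. s \<ge> 0 \<Longrightarrow> \<bar>f (m + s) - f (m - s) - 2 * s * f' m\<bar> \<le> K * s ^ 3"
    using central_difference[of f f'] assms(2,3) by metis
  show ?thesis
  proof (rule midpoint_consistentI)
    fix N i :: nat
    assume i: "i < N"
    define m h where "m = mid_point N i" and "h = mesh N"
    have h: "h > 0"
      using i by (simp add: h_def mesh_def)
    have "\<bar>f (m + h / 2) - f (m - h / 2) - h * f' m\<bar> \<le> K / 8 * h ^ 3"
      using K[of "h / 2" m] h by (simp add: power_divide)
    hence "\<bar>f (m + h / 2) - f (m - h / 2) - h * f' m\<bar> / h \<le> K / 8 * h ^ 3 / h"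
      using h by (intro divide_right_mono) auto
    moreover have "(f (m + h / 2) - f (m - h / 2)) / h - f' m
        = (f (m + h / 2) - f (m - h / 2) - h * f' m) / h"
      using h by (simp add: field_simps)
    ultimately have "\<bar>(f (m + h / 2) - f (m - h / 2)) / h - f' m\<bar> \<le> K / 8 * h\<^sup>2"
      using h by (simp add: power2_eq_square power3_eq_cube)
    thus "\<bar>(f (grid_point N (next_idx N i)) - f (grid_point N i)) / mesh N - f' (mid_point N i)\<bar>
        \<le> K / 8 * (mesh N)\<^sup>2"
      using periodic_at_next_idx[of f, OF per i]
      by (simp add: grid_point_mid[of N i] m_def h_def)
  qed
qed

text \<open>The consistency error of the summand and the error of the midpoint rule are both \<open>O(h\<^sup>3)\<close> on
  each cell, after multiplication of the former by \<open>h\<close>.\<close>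
lemma midpoint_consistent_quadrature:
  assumes q: "midpoint_consistent q g" and g: "bounded_C2 g"
  shows "(\<lambda>N. mesh N * (\<Sum>i<N. q N i) - integral {0..1} g) \<in> O(\<lambda>N. (mesh N)\<^sup>2)"
proof -
  obtain C where C: "C \<ge> 0"
    "\<forall>\<^sub>F N in sequentially. \<forall>i<N. \<bar>q N i - g (mid_point N i)\<bar> \<le> C * (mesh N)\<^sup>2"
    using midpoint_consistentE[OF q] .
  obtain K where K:
    "\<And>m s. s \<ge> 0 \<Longrightarrow> \<bar>integral {m - s..m + s} g - 2 * s * g m\<bar> \<le> K * s ^ 3"
    using midpoint_rule[OF g] by metis
  have *: "\<bar>mesh N * (\<Sum>i<N. q N i) - integral {0..1} g\<bar> \<le> (C + K / 8) * (mesh N)\<^sup>2"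
    if N: "N > 0" and qN: "\<forall>i<N. \<bar>q N i - g (mid_point N i)\<bar> \<le> C * (mesh N)\<^sup>2" for N
  proof -
    define h where "h = mesh N"
    have h: "h > 0" "real N * h = 1"
      using N by (simp_all add: h_def mesh_def)
    let ?cell = "\<lambda>i. integral {real i * h..(real i + 1) * h} g"
    have cell: "\<bar>h * q N i - ?cell i\<bar> \<le> (C + K / 8) * h ^ 3" if "i < N" for i
    proof -
      define m where "m = mid_point N i"
      have "{m - h / 2..m + h / 2} = {real i * h..(real i + 1) * h}"
        by (simp add: m_def mid_point_def h_def algebra_simps)
      hence "\<bar>?cell i - h * g m\<bar> \<le> K / 8 * h ^ 3"
        using K[of "h / 2" m] h by (simp add: power_divide)
      moreover have "h * \<bar>q N i - g m\<bar> \<le> h * (C * h\<^sup>2)"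
        using qN that h by (intro mult_left_mono) (auto simp: m_def h_def)
      hence "\<bar>h * q N i - h * g m\<bar> \<le> C * h ^ 3"
        using h by (simp add: right_diff_distrib[symmetric] abs_mult power2_eq_square
            power3_eq_cube mult.left_commute)
      ultimately show ?thesis
        unfolding distrib_right by linarith
    qed
    \<comment> \<open>The \<open>N\<close> errors of order \<open>h\<^sup>3\<close> add up to order \<open>h\<^sup>2\<close> because \<open>N h = 1\<close>.\<close>
    have "integral {0..1} g = (\<Sum>i<N. ?cell i)"
      using integral_eq_sum_cells[of g h N] bounded_C2_imp_continuous_on[OF g] h by simp
    hence "h * (\<Sum>i<N. q N i) - integral {0..1} g = (\<Sum>i<N. h * q N i - ?cell i)"
      by (simp add: sum_subtractf sum_distrib_left)
    also have "\<bar>\<dots>\<bar> \<le> (\<Sum>i<N. (C + K / 8) * h ^ 3)"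
      using cell by (intro order_trans[OF sum_abs] sum_mono) auto
    also have "\<dots> = (C + K / 8) * h\<^sup>2 * (real N * h)"
      by (simp add: power2_eq_square power3_eq_cube)
    finally show ?thesis
      using h by (simp add: h_def)
  qed
  show ?thesis
    by (rule bigoI[of _ "C + K / 8"], rule eventually_mono
        [OF eventually_conj[OF C(2) eventually_gt_at_top[of 0]]]) (use * in simp)
qed

text \<open>For periodic functions the trapezoidal sum is the plain sum over the nodes: the difference
  telescopes around the circle.\<close>
lemma sum_grid_periodic_average:
  assumes per: "\<And>x. f (x + 1) = f x"
  shows "(\<Sum>i<N. (f (grid_point N i) + f (grid_point N (next_idx N i))) / 2)
    = (\<Sum>i<N. f (grid_point N i) :: real)"
proof (cases "N = 0")
  case False
  have "f (grid_point N (next_idx N i)) = f (grid_point N (Suc i))" if "i < N" for i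
    using periodic_at_next_idx[of f, OF per that]
    by (simp add: grid_point_def mid_point_def algebra_simps)
  hence "(\<Sum>i<N. f (grid_point N (next_idx N i)) - f (grid_point N i))
      = (\<Sum>i<N. f (grid_point N (Suc i)) - f (grid_point N i))"
    by (intro sum.cong) auto
  also have "\<dots> = f (grid_point N N) - f (grid_point N 0)"
    by (rule sum_lessThan_telescope)
  also have "\<dots> = 0"
    using False per[of 0] by (simp add: grid_point_def mesh_def)
  finally show ?thesis
    by (simp add: sum_subtractf sum.distrib sum_divide_distrib[symmetric])
qed simp

section \<open>The reconstructed edge coefficients\<close>

lemma le_sinh: 
  fixes t :: real
  assumes "t \<ge> 0"
  shows "t \<le> sinh t"
proof -
  have "\<exists>y. ((\<lambda>t. sinh t - t) has_real_derivative y) (at x) \<and> 0 \<le> y" for x :: real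
    by (rule exI[of _ "cosh x - 1"]) (auto intro!: derivative_eq_intros cosh_real_ge_1)
  hence "sinh 0 - 0 \<le> sinh t - t"
    by (intro DERIV_nonneg_imp_nondecreasing[OF assms]) blast
  thus ?thesis by simp
qed

lemma sinh_le_mult_cosh:
  fixes t :: real
  assumes "t \<ge> 0"
  shows "sinh t \<le> t * cosh t"
proof -
  have "\<exists>y. ((\<lambda>t. t * cosh t - sinh t) has_real_derivative y) (at x) \<and> 0 \<le> y"
    if "0 \<le> x" for x :: real
    by (rule exI[of _ "x * sinh x"]) (use that in \<open>auto intro!: derivative_eq_intros\<close>)
  hence "0 * cosh 0 - sinh 0 \<le> t * cosh t - sinh t"
    by (intro DERIV_nonneg_imp_nondecreasing[OF assms]) blast
  thus ?thesis by simp
qed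

lemma log_mean_commute: "log_mean a b = log_mean b a"
  using minus_divide_divide[of "b - a" "ln b - ln a"] by (simp add: log_mean_def)

text \<open>The logarithmic mean lies between the geometric and the arithmetic mean. With centre \<open>a\<close> and
  half-width \<open>s\<close> of the interval from \<open>v\<close> to \<open>w\<close>, the three means are \<open>exp a\<close> times \<open>1\<close>,
  \<open>sinh s / s\<close> and \<open>cosh s\<close>.\<close>
lemma log_mean_exp_bounds:
  "exp ((v + w) / 2) \<le> log_mean (exp v) (exp w)"
  "log_mean (exp v) (exp w) \<le> (exp v + exp w) / 2"
proof -
  have "exp ((v + w) / 2) \<le> log_mean (exp v) (exp w)
      \<and> log_mean (exp v) (exp w) \<le> (exp v + exp w) / 2" if "v < w" for v w
  proof -
    define a s where "a = (v + w) / 2" and "s = (w - v) / 2"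
    have s: "s > 0" using that by (simp add: s_def)
    have v: "v = a - s" and w: "w = a + s"
      by (simp_all add: a_def s_def field_simps)
    have "log_mean (exp v) (exp w) = (exp (a + s) - exp (a - s)) / (2 * s)"
      using s unfolding v w by (simp add: log_mean_def)
    also have "\<dots> = exp a * (sinh s / s)"
      using s by (simp add: sinh_field_def exp_add exp_diff exp_minus field_simps)
    finally have L: "log_mean (exp v) (exp w) = exp a * (sinh s / s)" .
    have A: "(exp v + exp w) / 2 = exp a * cosh s"
      unfolding v w by (simp add: cosh_field_def exp_add exp_diff exp_minus field_simps)
    have "1 \<le> sinh s / s" "sinh s / s \<le> cosh s"
      using le_sinh[of s] sinh_le_mult_cosh[of s] s by (simp_all add: field_simps)
    thus ?thesis
      unfolding L A a_def[symmetric]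
      by (intro conjI mult_left_mono) (auto simp: mult_le_cancel_left1 simp del: times_divide_eq_right)
  qed
  note less = this
  have "exp ((v + w) / 2) \<le> log_mean (exp v) (exp w)
      \<and> log_mean (exp v) (exp w) \<le> (exp v + exp w) / 2"
  proof (cases v w rule: linorder_cases)
    case equal
    thus ?thesis
      by (simp add: log_mean_def)
  next
    case greater
    thus ?thesis
      using less[of w v] by (simp only: log_mean_commute[of "exp v" "exp w"] add.commute)
  qed (rule less)
  thus "exp ((v + w) / 2) \<le> log_mean (exp v) (exp w)"
    "log_mean (exp v) (exp w) \<le> (exp v + exp w) / 2"
    by auto
qed

text \<open>The two outer means are the \<open>IWPE\<close> and \<open>AM\<close> coefficients. In between, in increasing order,
  lie \<open>SG_WPE\<close>, the geometric mean \<open>ED\<close> and \<open>LM\<close>, by the bounds on the logarithmic mean of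
  \<open>exp v\<close>, \<open>exp w\<close> and of \<open>exp (- v)\<close>, \<open>exp (- w)\<close>.\<close>
lemma edge_coeff_bounds:
  "inverse ((exp v + exp w) / 2) \<le> edge_coeff rec v w"
  "edge_coeff rec v w \<le> (exp (- v) + exp (- w)) / 2"
proof -
  let ?H = "inverse ((exp v + exp w) / 2)" and ?G = "exp (- ((v + w) / 2))"
    and ?A = "(exp (- v) + exp (- w)) / 2"
  have SG: "?H \<le> inverse (log_mean (exp v) (exp w))" "inverse (log_mean (exp v) (exp w)) \<le> ?G"
  proof -
    have pos: "log_mean (exp v) (exp w) > 0"
      using log_mean_exp_bounds(1)[of v w] by (meson exp_gt_zero less_le_trans)
    show "?H \<le> inverse (log_mean (exp v) (exp w))"
      using log_mean_exp_bounds(2)[of v w] pos by (rule le_imp_inverse_le)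
    have "inverse (log_mean (exp v) (exp w)) \<le> inverse (exp ((v + w) / 2))"
      using log_mean_exp_bounds(1)[of v w] by (rule le_imp_inverse_le) simp
    thus "inverse (log_mean (exp v) (exp w)) \<le> ?G"
      by (simp add: exp_minus)
  qed
  have LM: "?G \<le> log_mean (exp (- v)) (exp (- w))" "log_mean (exp (- v)) (exp (- w)) \<le> ?A"
    using log_mean_exp_bounds[of "- v" "- w"] by (simp_all add: add_divide_distrib diff_divide_distrib)
  have ED: "sqrt (exp (- v) * exp (- w)) = ?G"
    by (simp add: real_sqrt_unique exp_add[symmetric] power2_eq_square)
  have "?H \<le> edge_coeff rec v w \<and> edge_coeff rec v w \<le> ?A"
    using SG LM ED by (cases rec) (auto simp: inverse_eq_divide)
  thus "?H \<le> edge_coeff rec v w" "edge_coeff rec v w \<le> ?A"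
    by auto
qed

lemma midpoint_consistent_gamma_rec:
  assumes "\<And>x. V (x + 1) = V x" "bounded_C2 V"
  shows "midpoint_consistent (\<lambda>N. gamma_rec rec N V) (\<lambda>x. exp (- V x))"
proof -
  have upper: "midpoint_consistent
      (\<lambda>N i. (exp (- V (grid_point N i)) + exp (- V (grid_point N (next_idx N i)))) / 2)
      (\<lambda>x. exp (- V x))"
    using assms by (intro midpoint_consistent_average bounded_C2_exp bounded_C2_minus) auto
  obtain B where B: "\<And>x. \<bar>V x\<bar> \<le> B"
    using bounded_C2_imp_bounded[OF assms(2)] by (auto simp: bounded_range_real_iff)
  have lower: "exp (- B) \<le> exp (V x)" for x
    using B[of x] by (simp add: abs_le_iff)
  have "midpoint_consistent
      (\<lambda>N i. inverse ((exp (V (grid_point N i)) + exp (V (grid_point N (next_idx N i)))) / 2))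
      (\<lambda>x. inverse (exp (V x)))"
  proof (rule midpoint_consistent_inverse)
    show "midpoint_consistent
        (\<lambda>N i. (exp (V (grid_point N i)) + exp (V (grid_point N (next_idx N i)))) / 2)
        (\<lambda>x. exp (V x))"
      using assms by (intro midpoint_consistent_average bounded_C2_exp) auto
    show "exp (- B) \<le> (exp (V (grid_point N i)) + exp (V (grid_point N (next_idx N i)))) / 2"
      for N i
      using add_mono[OF lower[of "grid_point N i"] lower[of "grid_point N (next_idx N i)"]]
      by simp
  qed (use lower in auto)
  hence "midpoint_consistent
      (\<lambda>N i. inverse ((exp (V (grid_point N i)) + exp (V (grid_point N (next_idx N i)))) / 2))
      (\<lambda>x. exp (- V x))"
    by (simp add: exp_minus)
  from this upper show ?thesis
    unfolding gamma_rec_def by (rule midpoint_consistent_squeeze) (rule edge_coeff_bounds)+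
qed

section \<open>Consistency of the free energy and of the dissipation\<close>

theorem proposition3p3:
  fixes V \<rho> :: "real \<Rightarrow> real" and \<rho>_min :: real
    and R :: "nat \<Rightarrow> (nat \<Rightarrow> real) \<Rightarrow> nat \<Rightarrow> real"
  assumes "C_per 2 V" and "C_per 2 \<rho>" and "C_per 3 (chem_pot V \<rho>)"
    and "\<rho>_min > 0" and "\<And>x. \<rho> x \<ge> \<rho>_min"
    and "\<exists>C. \<forall>\<^sub>F N in sequentially. \<forall>i<N.
           \<bar>R N (grid_proj N \<rho>) i - \<rho> (mid_point N i)\<bar> \<le> C * (mesh N)\<^sup>2"
  shows "(\<lambda>N. free_energy_h N V (grid_proj N \<rho>) - free_energy V \<rho>) \<in> O(\<lambda>N. (mesh N)\<^sup>2) \<and>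
    (\<lambda>N. dissipation_h N V R (grid_proj N \<rho>) - dissipation V \<rho>) \<in> O(\<lambda>N. (mesh N)\<^sup>2) \<and>
    (\<forall>rec.
      (\<lambda>N. dissipation_ME N V (gamma_rec rec N V) (grid_proj N \<rho>)
             - dissipation_h N V R (grid_proj N \<rho>)) \<in> O(\<lambda>N. (mesh N)\<^sup>2) \<and>
      (\<lambda>N. dissipation_ME N V (gamma_rec rec N V) (grid_proj N \<rho>)
             - dissipation V \<rho>) \<in> O(\<lambda>N. (mesh N)\<^sup>2))"
proof -
  define \<mu> where "\<mu> = chem_pot V \<rho>"
  have per: "V (x + 1) = V x" "\<rho> (x + 1) = \<rho> x" "\<mu> (x + 1) = \<mu> x" for x
    using assms(1-3) by (auto simp: C_per_def \<mu>_def)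
  have V: "bounded_C2 V" and \<rho>: "bounded_C2 \<rho>" and \<mu>: "bounded_C2 \<mu>"
    using C_per_bounded_C2[of _ _ 0] assms(1-3) by (fastforce simp: \<mu>_def)+
  have \<mu>': "bounded_C2 (deriv \<mu>)"
    using C_per_bounded_C2[of 3 \<mu> 1] assms(3) by (simp add: \<mu>_def)
  have D\<mu>: "(\<mu> has_real_derivative deriv \<mu> x) (at x)" for x
    using C_per_has_derivative[of 3 \<mu> 0] assms(3) by (simp add: \<mu>_def)
  \<comment> \<open>Positivity of the density makes \<open>exp\<close> undo the logarithm in the potential.\<close>
  have exp_\<mu>: "exp (\<mu> x) = \<rho> x * exp (V x)" for x
    using assms(4) assms(5)[of x] by (simp add: \<mu>_def chem_pot_def exp_add)
  have \<mu>_h: "chem_pot_h N V (grid_proj N \<rho>) i = \<mu> (grid_point N i)" for N i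
    by (simp add: chem_pot_h_def grid_proj_def \<mu>_def chem_pot_def)
  note bounded = bounded_C2_imp_bounded

  let ?f = "\<lambda>x. \<rho> x * (\<mu> x - 1)"
  have f: "\<rho> x * ln (\<rho> x) - \<rho> x + \<rho> x * V x = ?f x" for x
    by (simp add: \<mu>_def chem_pot_def algebra_simps)
  have C2_f: "bounded_C2 ?f"
    by (intro bounded_C2_mult bounded_C2_diff bounded_C2_const \<rho> \<mu>)
  have per_f: "?f (x + 1) = ?f x" for x
    by (simp add: per)
  have energy: "(\<lambda>N. free_energy_h N V (grid_proj N \<rho>) - free_energy V \<rho>) \<in> O(\<lambda>N. (mesh N)\<^sup>2)"
    using midpoint_consistent_quadrature[OF midpoint_consistent_average[OF per_f C2_f] C2_f]
    unfolding sum_grid_periodic_average[of ?f, OF per_f]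
    by (simp only: free_energy_h_def free_energy_def grid_proj_def f)

  let ?D = "\<lambda>N i. (\<mu> (grid_point N (next_idx N i)) - \<mu> (grid_point N i)) / mesh N"
  let ?g = "\<lambda>x. \<rho> x * (deriv \<mu> x * deriv \<mu> x)"
  have C2_g: "bounded_C2 ?g"
    by (intro bounded_C2_mult \<rho> \<mu>')
  have g: "dissipation V \<rho> = integral {0..1} ?g"
    by (simp add: dissipation_def \<mu>_def power2_eq_square)
  have D: "midpoint_consistent ?D (deriv \<mu>)"
    by (intro midpoint_consistent_difference_quotient per D\<mu> \<mu>')
  have R: "midpoint_consistent (\<lambda>N. R N (grid_proj N \<rho>)) \<rho>"
    unfolding midpoint_consistent_def by (rule assms(6))
  have "midpoint_consistent (\<lambda>N i. R N (grid_proj N \<rho>) i * (?D N i * ?D N i)) ?g"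
    by (intro midpoint_consistent_mult R D bounded bounded_C2_mult \<rho> \<mu>')
  from midpoint_consistent_quadrature[OF this C2_g]
  have diss: "(\<lambda>N. dissipation_h N V R (grid_proj N \<rho>) - dissipation V \<rho>) \<in> O(\<lambda>N. (mesh N)\<^sup>2)"
    unfolding g dissipation_h_def \<mu>_h power2_abs by (simp only: power2_eq_square)

  let ?E = "\<lambda>N i. (exp (\<mu> (grid_point N (next_idx N i))) - exp (\<mu> (grid_point N i))) / mesh N"
  have E: "midpoint_consistent ?E (\<lambda>x. exp (\<mu> x) * deriv \<mu> x)"
  proof (rule midpoint_consistent_difference_quotient)
    show "((\<lambda>x. exp (\<mu> x)) has_real_derivative exp (\<mu> x) * deriv \<mu> x) (at x)" for x
      by (auto intro!: derivative_eq_intros D\<mu>)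
  qed (simp_all add: per bounded_C2_mult bounded_C2_exp \<mu> \<mu>')
  have ME: "(\<lambda>N. dissipation_ME N V (gamma_rec rec N V) (grid_proj N \<rho>) - dissipation V \<rho>)
      \<in> O(\<lambda>N. (mesh N)\<^sup>2)" for rec
  proof -
    have "midpoint_consistent (\<lambda>N i. gamma_rec rec N V i * ?E N i * ?D N i)
        (\<lambda>x. exp (- V x) * (exp (\<mu> x) * deriv \<mu> x) * deriv \<mu> x)"
      by (intro midpoint_consistent_mult midpoint_consistent_gamma_rec D E bounded bounded_C2_mult
          bounded_C2_exp bounded_C2_minus V \<mu> \<mu>' per)
    moreover have "exp (- V x) * (exp (\<mu> x) * deriv \<mu> x) * deriv \<mu> x = ?g x" for x
      unfolding exp_\<mu> by (simp add: exp_minus)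
    ultimately have "midpoint_consistent (\<lambda>N i. gamma_rec rec N V i * ?E N i * ?D N i) ?g"
      by simp
    from midpoint_consistent_quadrature[OF this C2_g] show ?thesis
      unfolding g by (simp only: dissipation_ME_def \<mu>_h)
  qed
  have "(\<lambda>N. dissipation_ME N V (gamma_rec rec N V) (grid_proj N \<rho>)
      - dissipation_h N V R (grid_proj N \<rho>)) \<in> O(\<lambda>N. (mesh N)\<^sup>2)" for rec
    using sum_in_bigo(2)[OF ME[of rec] diss] by simp
  with energy diss ME show ?thesis
    by blast
qed

end
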